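(* Let $G$ be a finite group, $T_0,T_1\subseteq G$, and let $X=BD(G,T_0,T_1)$ be the Bi-Cayley digraph. If $X$ is strongly connected, then $\kappa(X)=\delta(X)$.
   Context: The Bi-Cayley digraph $BD(G,T_0,T_1)$ is the bipartite digraph with vertex set $G\times\{0,1\}$ and arc set $\{((g,0),(t_0g,1)) : g\in G,\ t_0\in T_0\}\cup\{((t_1g,1),(g,0)) : g\in G,\ t_1\in T_1\}$. Digraphs have no loops and no multiple arcs. For a digraph $X$, $\delta(X)$ is the minimum of the minimum out-degree and the minimum in-degree of $X$. The connectivity $\kappa(X)$ of a nontrivial digraph $X$ is the minimum cardinality of a vertex set $F$ such that the digraph obtained from $X$ by deleting $F$ is either trivial (exactly one vertex) or not strongly connected. *)

theory Defs
  imports "HOL-Algebra.Group" "Graph_Theory.Graph_Theory"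
begin

definition bi_cayley_digraph ::
  "('a, 'm) monoid_scheme \<Rightarrow> 'a set \<Rightarrow> 'a set \<Rightarrow> ('a \<times> nat) pair_pre_digraph" where
  "bi_cayley_digraph G T0 T1 =
    \<lparr> pverts = carrier G \<times> {0, 1},
      parcs = {((g, 0), (t0 \<otimes>\<^bsub>G\<^esub> g, 1)) | g t0. g \<in> carrier G \<and> t0 \<in> T0}
            \<union> {((t1 \<otimes>\<^bsub>G\<^esub> g, 1), (g, 0)) | g t1. g \<in> carrier G \<and> t1 \<in> T1} \<rparr>"

lemma (in group) digraph_bi_cayley_digraph:
  assumes "finite (carrier G)" "T0 \<subseteq> carrier G" "T1 \<subseteq> carrier G"
  shows "digraph (with_proj (bi_cayley_digraph G T0 T1))"
proof -
  let ?X = "bi_cayley_digraph G T0 T1"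
  have sub: "parcs ?X \<subseteq> pverts ?X \<times> pverts ?X"
    using assms(2,3) by (auto simp: bi_cayley_digraph_def)
  have fin: "finite (pverts ?X)"
    using assms(1) by (simp add: bi_cayley_digraph_def)
  have loop: "fst e \<noteq> snd e" if "e \<in> parcs ?X" for e
    using that by (auto simp: bi_cayley_digraph_def)
  have "finite (parcs ?X)"
    using finite_subset[OF sub] fin by simp
  with sub fin loop have "pair_digraph ?X"
    by unfold_locales auto
  then interpret pair_digraph ?X .
  show ?thesis by unfold_locales
qed

text \<open>\<^const>\<open>Min\<close> is only specified on finite nonempty sets: the two definitions below are
  meant for finite digraphs, and the first one also requires a vertex.\<close>

definition min_semidegree :: "('a, 'b) pre_digraph \<Rightarrow> nat" where
  "min_semidegree X = min (Min (out_degree X ` verts X)) (Min (in_degree X ` verts X))"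

text \<open>\<^const>\<open>strongly_connected\<close> is false for the digraph without vertices, so
  \<open>F = verts X\<close> is admitted below. It never affects the minimum, since deleting all
  vertices but one already leaves a trivial digraph.\<close>

definition connectivity :: "('a, 'b) pre_digraph \<Rightarrow> nat" where
  "connectivity X =
    Min {card F | F. F \<subseteq> verts X \<and>
      (card (verts X - F) = 1 \<or> \<not> strongly_connected (X \<restriction> (verts X - F)))}"

end

theory Submission
  imports Defs
begin

text \<open>A separator of fewer than \<open>\<delta>\<close> vertices yields a set with small boundary, hence an atom: a
  smallest set of minimal boundary, in the digraph or its reverse. By submodularity an atom is
  contained in every fragment it meets, so it is a block for the right translations. If its
  boundary had fewer than \<open>\<delta>\<close> elements, the atom would meet both colour classes, and its
  stabiliser \<open>H\<close> would act regularly on both parts, which therefore have \<open>|H|\<close> elements. The two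
  colour parts of the boundary are unions of \<open>H\<close>-orbits of sizes \<open>p, q \<ge> \<delta> - |H|\<close>, not both empty.
  If neither is empty then \<open>p + q \<ge> (\<delta> - |H|) + |H|\<close>; if one is, then \<open>\<delta> \<le> |H|\<close> and the other has
  at least \<open>|H|\<close> elements.\<close>

subsection \<open>Fragments and atoms\<close>

definition boundary :: "'v rel \<Rightarrow> 'v set \<Rightarrow> 'v set" where
  "boundary E A = E `` A - A"

definition exterior :: "'v set \<Rightarrow> 'v rel \<Rightarrow> 'v set \<Rightarrow> 'v set" where
  "exterior V E A = V - (A \<union> E `` A)"

text \<open>Deleting \<open>boundary E A\<close> leaves no path from \<open>A\<close> to its
  exterior, so nonemptiness of both sides makes the boundary a vertex cut.\<close>

definition separating :: "'v set \<Rightarrow> 'v rel \<Rightarrow> 'v set \<Rightarrow> bool" where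
  "separating V E A \<longleftrightarrow> A \<subseteq> V \<and> A \<noteq> {} \<and> exterior V E A \<noteq> {}"

definition fragment :: "'v set \<Rightarrow> 'v rel \<Rightarrow> 'v set \<Rightarrow> bool" where
  "fragment V E A \<longleftrightarrow> separating V E A \<and>
    (\<forall>B. separating V E B \<longrightarrow> card (boundary E A) \<le> card (boundary E B))"

text \<open>Exteriors of fragments are the fragments of the reverse relation, so the size is minimal
  over both orientations at once.\<close>

definition atom :: "'v set \<Rightarrow> 'v rel \<Rightarrow> 'v set \<Rightarrow> bool" where
  "atom V E A \<longleftrightarrow> fragment V E A \<and>
    (\<forall>B. fragment V E B \<longrightarrow> card A \<le> card B \<and> card A \<le> card (exterior V E B))"

text \<open>The union of the boundaries of \<open>A \<inter> B\<close> and
  \<open>A \<union> B\<close> lies in the union of those of \<open>A\<close> and \<open>B\<close>,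
  and likewise for the intersections; inclusion-exclusion adds the two estimates.\<close>

lemma boundary_submodular:
  assumes "finite V" "E \<subseteq> V \<times> V"
  shows "card (boundary E (A \<inter> B)) + card (boundary E (A \<union> B))
    \<le> card (boundary E A) + card (boundary E B)"
proof -
  have fin: "finite (boundary E C)" for C
    using assms by (auto simp: boundary_def intro: finite_subset[of _ V])
  have "card (boundary E (A \<inter> B) \<union> boundary E (A \<union> B)) \<le> card (boundary E A \<union> boundary E B)"
    using fin by (intro card_mono) (auto simp: boundary_def)
  moreover have "card (boundary E (A \<inter> B) \<inter> boundary E (A \<union> B))
      \<le> card (boundary E A \<inter> boundary E B)"
    using fin by (intro card_mono) (auto simp: boundary_def)
  ultimately show ?thesis
    using card_Un_Int[OF fin fin, of "A \<inter> B" "A \<union> B"]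
      card_Un_Int[OF fin fin, of A B] by linarith
qed

lemma card_exterior:
  assumes "finite V" "E \<subseteq> V \<times> V" "A \<subseteq> V"
  shows "card A + card (boundary E A) + card (exterior V E A) = card V"
proof -
  have "V = A \<union> boundary E A \<union> exterior V E A"
    using assms by (auto simp: boundary_def exterior_def)
  moreover have "card (A \<union> boundary E A \<union> exterior V E A)
      = card (A \<union> boundary E A) + card (exterior V E A)"
    using assms by (intro card_Un_disjoint)
      (auto simp: boundary_def exterior_def intro: finite_subset[of _ V])
  moreover have "card (A \<union> boundary E A) = card A + card (boundary E A)"
    using assms by (intro card_Un_disjoint)
      (auto simp: boundary_def intro: finite_subset[of _ V])
  ultimately show ?thesis by simp
qed

text \<open>Submodularity makes \<open>A \<inter> B\<close> a fragment as soon as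
  \<open>A \<union> B\<close> is separating too; minimality of the atom then leaves no room for a
  proper subset.\<close>

lemma atom_subset_fragment:
  assumes V: "finite V" "E \<subseteq> V \<times> V" and A: "atom V E A" and B: "fragment V E B"
    and meet: "A \<inter> B \<noteq> {}"
  shows "A \<subseteq> B"
proof -
  have fA: "fragment V E A" using A by (simp add: atom_def)
  have sub: "A \<subseteq> V" "B \<subseteq> V" using fA B by (auto simp: fragment_def separating_def)
  have fin: "finite A" "finite B" using sub V finite_subset by blast+
  have eq: "card (boundary E A) = card (boundary E B)"
    using fA B by (auto simp: fragment_def intro: antisym)
  have "exterior V E A \<subseteq> exterior V E (A \<inter> B)" unfolding exterior_def by blast
  then have sep: "separating V E (A \<inter> B)"
    using fA meet sub unfolding fragment_def separating_def by blast
  then have ge: "card (boundary E A) \<le> card (boundary E (A \<inter> B))"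
    using fA unfolding fragment_def by blast
  note submod = boundary_submodular[OF V, of A B]
  \<comment> \<open>If the union had empty exterior, counting \<open>V\<close> through
    \<open>B\<close> and through \<open>A \<union> B\<close>, with \<open>A\<close> no larger than
    the exterior of \<open>B\<close>, would make the boundary of the union exceed that of
    \<open>B\<close> by at least \<open>card (A \<inter> B)\<close>. Submodularity forbids
    this.\<close>
  have "separating V E (A \<union> B)"
  proof (rule ccontr)
    assume "\<not> ?thesis"
    then have "exterior V E (A \<union> B) = {}" using sub meet by (auto simp: separating_def)
    then have "card (A \<union> B) + card (boundary E (A \<union> B)) = card V"
      using card_exterior[OF V, of "A \<union> B"] sub by simp
    moreover have "card A + card B = card (A \<union> B) + card (A \<inter> B)"
      using fin by (rule card_Un_Int)
    moreover have "card A \<le> card (exterior V E B)" using A B by (simp add: atom_def)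
    moreover have "card (A \<inter> B) > 0" using fin meet by (simp add: card_gt_0_iff)
    ultimately show False
      using card_exterior[OF V sub(2)] submod eq ge by linarith
  qed
  then have "card (boundary E A) \<le> card (boundary E (A \<union> B))"
    using fA unfolding fragment_def by blast
  then have "card (boundary E (A \<inter> B)) \<le> card (boundary E A)"
    using submod eq by linarith
  then have "fragment V E (A \<inter> B)"
    using sep fA by (auto simp: fragment_def intro: order_trans)
  then have "card A \<le> card (A \<inter> B)" using A by (simp add: atom_def)
  then have "A \<inter> B = A" using fin by (intro card_seteq) auto
  then show ?thesis by blast
qed

section \<open>Duality between a digraph and its reverse\<close>

text \<open>No arc goes from \<open>B\<close> to its exterior, so every arc entering the exterior
  from outside starts in the boundary of \<open>B\<close>.\<close>

lemma separating_exterior: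
  assumes "E \<subseteq> V \<times> V" "separating V E B"
  shows "separating V (E\<inverse>) (exterior V E B)"
    and "boundary (E\<inverse>) (exterior V E B) \<subseteq> boundary E B"
  using assms unfolding separating_def exterior_def boundary_def by auto

text \<open>Taking exteriors never enlarges the boundary, in either orientation, so both
  orientations have the same minimum. For a fragment the inclusion of boundaries is therefore an
  equality, and taking the exterior twice gives back \<open>B\<close>.\<close>

lemma fragment_exterior:
  assumes V: "finite V" "E \<subseteq> V \<times> V" and B: "fragment V E B"
  shows "fragment V (E\<inverse>) (exterior V E B)"
    and "card (boundary (E\<inverse>) (exterior V E B)) = card (boundary E B)"
    and "exterior V (E\<inverse>) (exterior V E B) = B"
proof -
  have V': "E\<inverse> \<subseteq> V \<times> V" using V by auto
  have finb: "finite (boundary R C)" if "R \<subseteq> V \<times> V" for R C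
    using V that by (auto simp: boundary_def intro: finite_subset[of _ V])
  let ?D = "exterior V E B"
  have sB: "separating V E B" using B by (simp add: fragment_def)
  note D = separating_exterior[OF V(2) sB]
  have low: "card (boundary E B) \<le> card (boundary (E\<inverse>) C)" if "separating V (E\<inverse>) C" for C
  proof -
    note C = separating_exterior[OF V' that, simplified]
    have "card (boundary E B) \<le> card (boundary E (exterior V (E\<inverse>) C))"
      using B C(1) by (auto simp: fragment_def)
    also have "\<dots> \<le> card (boundary (E\<inverse>) C)"
      using C(2) finb[OF V'] by (intro card_mono)
    finally show ?thesis .
  qed
  have "card (boundary (E\<inverse>) ?D) \<le> card (boundary E B)"
    using D(2) finb[OF V(2)] by (intro card_mono)
  with low[OF D(1)] show eq: "card (boundary (E\<inverse>) ?D) = card (boundary E B)" by simp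
  show "fragment V (E\<inverse>) ?D" using D(1) low eq by (simp add: fragment_def)
  have "boundary (E\<inverse>) ?D = boundary E B"
    using D(2) eq finb[OF V(2)] by (intro card_subset_eq)
  then show "exterior V (E\<inverse>) ?D = B"
    using sB V(2) unfolding separating_def exterior_def boundary_def by blast
qed

text \<open>Minimising over the fragments and their exteriors at once gives an atom of the digraph
  or of its reverse.\<close>

lemma ex_atom:
  assumes V: "finite V" "E \<subseteq> V \<times> V" and S: "separating V E S"
  obtains A where "atom V E A" "card (boundary E A) \<le> card (boundary E S)"
  | A where "atom V (E\<inverse>) A" "card (boundary (E\<inverse>) A) \<le> card (boundary E S)"
proof -
  have V': "E\<inverse> \<subseteq> V \<times> V" using V by auto
  obtain B0 where "fragment V E B0"
    using ex_has_least_nat[of "separating V E" S "\<lambda>B. card (boundary E B)"] S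
    by (auto simp: fragment_def)
  then obtain B where B: "fragment V E B"
    and min: "\<And>C. fragment V E C \<Longrightarrow>
      min (card B) (card (exterior V E B)) \<le> min (card C) (card (exterior V E C))"
    using ex_has_least_nat[of "fragment V E" B0 "\<lambda>B. min (card B) (card (exterior V E B))"]
    by blast
  have BS: "card (boundary E B) \<le> card (boundary E S)" using B S by (simp add: fragment_def)
  show ?thesis
  proof (cases "card B \<le> card (exterior V E B)")
    case True
    then have "atom V E B" using B min by (force simp: atom_def)
    then show ?thesis using BS that(1) by blast
  next
    case False
    have "atom V (E\<inverse>) (exterior V E B)"
      unfolding atom_def
    proof (intro conjI allI impI)
      show "fragment V (E\<inverse>) (exterior V E B)" using fragment_exterior(1)[OF V B] .
    next
      fix C assume C: "fragment V (E\<inverse>) C"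
      \<comment> \<open>\<open>C\<close> is itself the exterior of a fragment of \<open>E\<close>,
        so both sizes to be compared already entered the minimum.\<close>
      note D = fragment_exterior[OF V(1) V' C, simplified]
      show "card (exterior V E B) \<le> card C" "card (exterior V E B) \<le> card (exterior V (E\<inverse>) C)"
        using min[OF D(1)] False D(3) by auto
    qed
    then show ?thesis using BS fragment_exterior(2)[OF V B] that(2) by simp
  qed
qed

subsection \<open>Translation-invariant bipartite relations\<close>

text \<open>The connection sets of a Bi-Cayley digraph multiply on the left, so right multiplication
  commutes with them and yields automorphisms.\<close>

definition right_translate :: "('a, 'm) monoid_scheme \<Rightarrow> 'a \<Rightarrow> 'a \<times> nat \<Rightarrow> 'a \<times> nat" where
  "right_translate G g v = (fst v \<otimes>\<^bsub>G\<^esub> g, snd v)"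

definition right_invariant :: "('a, 'm) monoid_scheme \<Rightarrow> ('a \<times> nat) rel \<Rightarrow> bool" where
  "right_invariant G E \<longleftrightarrow>
    (\<forall>g \<in> carrier G. \<forall>(u, v) \<in> E. (right_translate G g u, right_translate G g v) \<in> E)"

context group
begin

lemma right_invariantD:
  "right_invariant G E \<Longrightarrow> g \<in> carrier G \<Longrightarrow> (u, v) \<in> E \<Longrightarrow>
    (right_translate G g u, right_translate G g v) \<in> E"
  by (auto simp: right_invariant_def)

lemma inj_on_right_translate:
  "g \<in> carrier G \<Longrightarrow> inj_on (right_translate G g) (carrier G \<times> I)"
  by (auto simp: inj_on_def right_translate_def)

lemma right_translate_image:
  assumes "g \<in> carrier G"
  shows "right_translate G g ` (carrier G \<times> I) = carrier G \<times> I"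
proof -
  have "(x, i) = right_translate G g (x \<otimes> inv g, i)" if "x \<in> carrier G" for x and i :: nat
    using that assms by (simp add: right_translate_def m_assoc)
  then show ?thesis using assms by (force simp: right_translate_def)
qed

lemma right_translate_boundary:
  assumes E: "E \<subseteq> (carrier G \<times> I) \<times> (carrier G \<times> I)"
    and inv: "right_invariant G E"
    and g: "g \<in> carrier G" and A: "A \<subseteq> carrier G \<times> I"
  shows "E `` (right_translate G g ` A) = right_translate G g ` (E `` A)"
    and "boundary E (right_translate G g ` A) = right_translate G g ` boundary E A"
proof -
  let ?t = "right_translate G"
  have left_cancel: "?t (inv g) (?t g u) = u" if "u \<in> carrier G \<times> I" for u
    using that g by (auto simp: right_translate_def m_assoc)
  have right_cancel: "?t g (?t (inv g) u) = u" if "u \<in> carrier G \<times> I" for u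
    using that g by (auto simp: right_translate_def m_assoc)
  show *: "E `` (?t g ` A) = ?t g ` (E `` A)"
  proof (intro equalityI subsetI)
    fix v assume "v \<in> E `` (?t g ` A)"
    then obtain u where u: "u \<in> A" "(?t g u, v) \<in> E" by auto
    \<comment> \<open>Invariance pushes arcs forward only; the arc is pulled back by translating
      with \<open>inv g\<close>.\<close>
    then have "(u, ?t (inv g) v) \<in> E" using right_invariantD[OF inv, of "inv g" "?t g u" v] g A left_cancel by force
    moreover have "v = ?t g (?t (inv g) v)" using u E right_cancel by auto
    ultimately show "v \<in> ?t g ` (E `` A)" using u by blast
  next
    fix v assume "v \<in> ?t g ` (E `` A)"
    then show "v \<in> E `` (?t g ` A)" using right_invariantD[OF inv g] by blast
  qed
  have "E `` A \<subseteq> carrier G \<times> I" using E by auto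
  then show "boundary E (?t g ` A) = ?t g ` boundary E A"
    unfolding boundary_def * using inj_on_image_set_diff[OF inj_on_right_translate[OF g]] A
    by blast
qed

lemma fragment_right_translate:
  assumes E: "E \<subseteq> (carrier G \<times> I) \<times> (carrier G \<times> I)"
    and inv: "right_invariant G E"
    and g: "g \<in> carrier G" and A: "fragment (carrier G \<times> I) E A"
  shows "fragment (carrier G \<times> I) E (right_translate G g ` A)"
proof -
  let ?t = "right_translate G g" and ?V = "carrier G \<times> I"
  have sub: "A \<subseteq> ?V" using A by (auto simp: fragment_def separating_def)
  have EA: "E `` A \<subseteq> ?V" using E by auto
  note tr = right_translate_boundary[OF E inv g sub]
  have "exterior ?V E (?t ` A) = ?t ` ?V - ?t ` (A \<union> E `` A)"
    unfolding exterior_def tr(1) right_translate_image[OF g] image_Un ..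
  also have "\<dots> = ?t ` exterior ?V E A"
    unfolding exterior_def
    using inj_on_image_set_diff[OF inj_on_right_translate[OF g], of ?V "A \<union> E `` A"] sub EA
    by auto
  finally have "separating ?V E (?t ` A)"
    using A sub right_translate_image[OF g, of I] by (auto simp: fragment_def separating_def)
  moreover have "card (boundary E (?t ` A)) = card (boundary E A)"
    unfolding tr(2) using EA inj_on_right_translate[OF g, of I]
    by (intro card_image) (auto simp: boundary_def intro: inj_on_subset)
  ultimately show ?thesis using A by (simp add: fragment_def)
qed

section \<open>Lower bound for the boundary of an atom\<close>

text \<open>The bound compares the colour layers of the atom, of size at most \<open>card H\<close>,
  with those of its boundary, of size at least \<open>card H\<close> unless empty. Only out-degrees
  are involved, so the same statement serves the reverse relation.\<close>

lemma card_boundary_atom_ge: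
  assumes fin: "finite (carrier G)"
    and E: "E \<subseteq> (carrier G \<times> {0, 1}) \<times> (carrier G \<times> {0, 1})"
    and bip: "\<And>u v. (u, v) \<in> E \<Longrightarrow> snd u \<noteq> snd v"
    and inv: "right_invariant G E"
    and deg: "\<And>v. v \<in> carrier G \<times> {0, 1} \<Longrightarrow> d \<le> card (E `` {v})"
    and conn: "\<And>A. A \<subseteq> carrier G \<times> {0, 1} \<Longrightarrow> A \<noteq> {} \<Longrightarrow> E `` A \<subseteq> A \<Longrightarrow>
      A = carrier G \<times> {0, 1}"
    and atom: "atom (carrier G \<times> {0, 1}) E A"
  shows "d \<le> card (boundary E A)"
proof -
  let ?t = "right_translate G" and ?V = "carrier G \<times> {0, 1 :: nat}"
  define H where "H = {g \<in> carrier G. ?t g ` A = A}"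
  have finV: "finite ?V" using fin by simp
  have frag: "fragment ?V E A" using atom by (simp add: atom_def)
  then have A: "A \<subseteq> ?V" "A \<noteq> {}" "exterior ?V E A \<noteq> {}"
    by (auto simp: fragment_def separating_def)
  have finA: "finite A" using A finV finite_subset by blast
  have bV: "boundary E A \<subseteq> ?V" using E by (auto simp: boundary_def)
  have finb: "finite (boundary E A)" using bV finV finite_subset by blast
  \<comment> \<open>Translates of \<open>A\<close> are fragments, so one that meets \<open>A\<close>
    contains it, and having no more elements it equals \<open>A\<close>.\<close>
  have block: "g \<in> H" if g: "g \<in> carrier G" and "A \<inter> ?t g ` A \<noteq> {}" for g
  proof -
    have "A \<subseteq> ?t g ` A"
      using atom_subset_fragment[OF finV E atom fragment_right_translate[OF E inv g frag]] that
      by blast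
    then have "A = ?t g ` A" using finA by (intro card_seteq) (auto intro: card_image_le)
    then show ?thesis using g by (simp add: H_def)
  qed
  \<comment> \<open>Two elements \<open>(a, i)\<close> and \<open>(b, i)\<close> of \<open>A\<close>
    differ by the translation with \<open>inv a \<otimes> b\<close>, which then lies in
    \<open>H\<close>; the layer sits inside a single left coset of \<open>H\<close>.\<close>
  have layer_le: "card {v \<in> A. snd v = i} \<le> card H" for i
  proof (cases "{v \<in> A. snd v = i} = {}")
    case True
    then show ?thesis by (simp only: card.empty)
  next
    case False
    then obtain a where a: "(a, i) \<in> A" by auto
    have "{v \<in> A. snd v = i} \<subseteq> (\<lambda>h. (a \<otimes> h, i)) ` H"
    proof
      fix v assume v: "v \<in> {v \<in> A. snd v = i}"
      then obtain b where b: "v = (b, i)" "(b, i) \<in> A" by (cases v) auto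
      have G: "a \<in> carrier G" "b \<in> carrier G" using a b A by auto
      then have eq: "(b, i) = ?t (inv a \<otimes> b) (a, i)"
        by (simp add: right_translate_def m_assoc[symmetric])
      then have "inv a \<otimes> b \<in> H" using a b G by (intro block) auto
      then show "v \<in> (\<lambda>h. (a \<otimes> h, i)) ` H"
        using eq b(1) by (auto simp: right_translate_def)
    qed
    moreover have "finite H" using fin by (simp add: H_def)
    ultimately show ?thesis by (meson surj_card_le)
  qed
  define P where "P i = {v \<in> boundary E A. snd v = i}" for i
  \<comment> \<open>The stabiliser of \<open>A\<close> preserves its boundary, and cancellation
    makes the orbit of a boundary vertex as large as \<open>H\<close>.\<close>
  have P_ge: "card H \<le> card (P i)" if ne: "P i \<noteq> {}" for i
  proof -
    obtain b where b: "(b, i) \<in> boundary E A" using ne by (auto simp: P_def)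
    have bG: "b \<in> carrier G" using b bV by auto
    have "(\<lambda>h. (b \<otimes> h, i)) ` H \<subseteq> P i"
    proof clarify
      fix h assume h: "h \<in> H"
      then have "?t h ` boundary E A = boundary E A"
        using right_translate_boundary(2)[OF E inv _ A(1), of h] by (simp add: H_def)
      then show "(b \<otimes> h, i) \<in> P i"
        using b by (force simp: P_def right_translate_def)
    qed
    moreover have "inj_on (\<lambda>h. (b \<otimes> h, i)) H"
      using bG by (auto simp: inj_on_def H_def)
    moreover have "finite (P i)" using finb by (simp add: P_def)
    ultimately show ?thesis by (meson card_inj_on_le)
  qed
  \<comment> \<open>All out-neighbours have the opposite colour and lie in \<open>A\<close> or its
    boundary. As \<open>i\<close> is 0 or 1, truncated subtraction in \<open>1 - i\<close> is
    harmless.\<close>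
  have P_deg: "d \<le> card (P (1 - i)) + card {v \<in> A. snd v = 1 - i}"
    if a: "(a, i) \<in> A" for a i
  proof -
    have "i \<le> 1" using a A by auto
    then have "snd v = 1 - i" if "((a, i), v) \<in> E" for v
      using bip[OF that] that E by force
    then have "E `` {(a, i)} \<subseteq> P (1 - i) \<union> {v \<in> A. snd v = 1 - i}"
      using a by (auto simp: P_def boundary_def)
    then have "card (E `` {(a, i)}) \<le> card (P (1 - i) \<union> {v \<in> A. snd v = 1 - i})"
      using finb finA by (intro card_mono) (auto simp: P_def)
    also have "\<dots> \<le> card (P (1 - i)) + card {v \<in> A. snd v = 1 - i}" by (rule card_Un_le)
    finally show ?thesis using deg[of "(a, i)"] a A by auto
  qed
  have "boundary E A = P 0 \<union> P 1" using bV by (auto simp: P_def)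
  moreover have "P 0 \<inter> P 1 = {}" by (auto simp: P_def)
  ultimately have card_b: "card (boundary E A) = card (P 0) + card (P 1)"
    using finb by (simp add: card_Un_disjoint)
  \<comment> \<open>Strong connectivity enters here: with empty boundary \<open>A\<close> would be
    closed, hence everything, and its exterior empty.\<close>
  have "boundary E A \<noteq> {}"
    using conn[OF A(1,2)] A(3) by (auto simp: boundary_def exterior_def)
  then have nonempty: "P 0 \<noteq> {} \<or> P 1 \<noteq> {}" using bV by (auto simp: P_def)
  show ?thesis
  proof (cases "(\<exists>a. (a, 0) \<in> A) \<and> (\<exists>a. (a, 1) \<in> A)")
    case True
    then have "d \<le> card (P 1) + card H" "d \<le> card (P 0) + card H"
      using P_deg[of _ 0] P_deg[of _ 1] layer_le[of 0] layer_le[of 1] by fastforce+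
    then show ?thesis
      using card_b nonempty P_ge[of 0] P_ge[of 1] by (cases "P 0 = {}"; cases "P 1 = {}") auto
  next
    case False
    obtain a i where a: "(a, i) \<in> A" using A(2) by auto
    then have "i = 0 \<or> i = 1" using A by auto
    \<comment> \<open>An atom within one colour class contains no out-neighbour of its vertices, so
      the boundary holds a whole out-neighbourhood.\<close>
    then have "{v \<in> A. snd v = 1 - i} = {}" using False a A(1) by auto
    then have "d \<le> card (P (1 - i))" using P_deg[OF a] by (simp only: card.empty add_0_right)
    then show ?thesis using card_b \<open>i = 0 \<or> i = 1\<close> by auto
  qed
qed

text \<open>The atom beneath a separating set may belong to either orientation, hence the bounds on
  both kinds of degree.\<close>

lemma card_boundary_separating_ge:
  assumes fin: "finite (carrier G)"
    and E: "E \<subseteq> (carrier G \<times> {0, 1}) \<times> (carrier G \<times> {0, 1})"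
    and bip: "\<And>u v. (u, v) \<in> E \<Longrightarrow> snd u \<noteq> snd v"
    and inv: "right_invariant G E"
    and out_deg: "\<And>v. v \<in> carrier G \<times> {0, 1} \<Longrightarrow> d \<le> card (E `` {v})"
    and in_deg: "\<And>v. v \<in> carrier G \<times> {0, 1} \<Longrightarrow> d \<le> card (E\<inverse> `` {v})"
    and conn: "\<And>A. A \<subseteq> carrier G \<times> {0, 1} \<Longrightarrow> A \<noteq> {} \<Longrightarrow> E `` A \<subseteq> A \<Longrightarrow>
      A = carrier G \<times> {0, 1}"
    and S: "separating (carrier G \<times> {0, 1}) E S"
  shows "d \<le> card (boundary E S)"
proof -
  let ?V = "carrier G \<times> {0, 1 :: nat}"
  \<comment> \<open>The complement of a set closed under predecessors is closed under
    successors.\<close>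
  have conn': "A = ?V" if "A \<subseteq> ?V" "A \<noteq> {}" "E\<inverse> `` A \<subseteq> A" for A
  proof (rule ccontr)
    assume "A \<noteq> ?V"
    moreover have "E `` (?V - A) \<subseteq> ?V - A" using that(3) E by blast
    ultimately have "?V - A = ?V" using that(1) by (intro conn) auto
    then show False using that by blast
  qed
  have finV: "finite ?V" using fin by simp
  show ?thesis
    using finV E S
  proof (rule ex_atom)
    fix A assume "atom ?V E A" "card (boundary E A) \<le> card (boundary E S)"
    then show ?thesis
      using card_boundary_atom_ge[OF fin E bip inv out_deg conn] by (meson order_trans)
  next
    fix A assume A: "atom ?V (E\<inverse>) A" "card (boundary (E\<inverse>) A) \<le> card (boundary E S)"
    have "d \<le> card (boundary (E\<inverse>) A)"
      by (rule card_boundary_atom_ge[OF fin _ _ _ in_deg conn' A(1)])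
        (use E bip inv in \<open>auto simp: right_invariant_def dest: bip\<close>)
    then show ?thesis using A(2) by simp
  qed
qed

end

subsection \<open>Connectivity and semidegrees\<close>

text \<open>Without parallel arcs, an arc leaving \<open>v\<close> is determined by its
  head.\<close>

lemma (in digraph) card_out_neighbours: "card (arcs_ends G `` {v}) = out_degree G v"
proof -
  have "arcs_ends G `` {v} = head G ` out_arcs G v"
    by (auto simp: arcs_ends_conv out_arcs_def)
  moreover have "inj_on (head G) (out_arcs G v)"
    using no_multi_arcs by (auto simp: inj_on_def out_arcs_def arc_to_ends_def)
  ultimately show ?thesis by (simp add: out_degree_def card_image)
qed

lemma (in digraph) card_in_neighbours: "card ((arcs_ends G)\<inverse> `` {v}) = in_degree G v"
proof -
  have "(arcs_ends G)\<inverse> `` {v} = tail G ` in_arcs G v"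
    by (auto simp: arcs_ends_conv in_arcs_def)
  moreover have "inj_on (tail G) (in_arcs G v)"
    using no_multi_arcs by (auto simp: inj_on_def in_arcs_def arc_to_ends_def)
  ultimately show ?thesis by (simp add: in_degree_def card_image)
qed

lemma (in wf_digraph) strongly_connected_closed_eq:
  assumes "strongly_connected G" "A \<subseteq> verts G" "A \<noteq> {}" "arcs_ends G `` A \<subseteq> A"
  shows "A = verts G"
proof -
  obtain u where u: "u \<in> A" using assms by auto
  have "v \<in> A" if "v \<in> verts G" for v
  proof -
    have "u \<rightarrow>\<^sup>*\<^bsub>G\<^esub> v" using assms u that by auto
    then show ?thesis by (induct rule: reachable_induct) (use u assms(4) in auto)
  qed
  then show ?thesis using assms by auto
qed

lemma (in digraph) arcs_ends_induce:
  "arcs_ends (G \<restriction> W) = arcs_ends G \<inter> W \<times> W"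
  by (auto simp: arcs_ends_def arc_to_ends_def)

text \<open>\<open>A\<close> consists of the vertices reachable from some \<open>u\<close> after
  deleting \<open>F\<close>, where \<open>u\<close> fails to reach some \<open>v\<close>; an arc can
  leave \<open>A\<close> only into \<open>F\<close>.\<close>

lemma (in digraph) ex_separating_set:
  assumes "F \<subseteq> verts G" "F \<noteq> verts G" "\<not> strongly_connected (G \<restriction> (verts G - F))"
  obtains A where "separating (verts G) (arcs_ends G) A" "boundary (arcs_ends G) A \<subseteq> F"
proof -
  let ?W = "verts G - F" and ?E = "arcs_ends G"
  obtain u v where uv: "u \<in> ?W" "v \<in> ?W" "(u, v) \<notin> rtrancl_on ?W (?E \<inter> ?W \<times> ?W)"
    using assms unfolding strongly_connected_def reachable_def arcs_ends_induce by auto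
  define A where "A = {w. (u, w) \<in> rtrancl_on ?W (?E \<inter> ?W \<times> ?W)}"
  have sub: "A \<subseteq> ?W" by (auto simp: A_def dest: in_rtrancl_on_in_F)
  have closed: "y \<in> A" if "x \<in> A" "(x, y) \<in> ?E" "y \<notin> F" for x y
  proof -
    have "y \<in> ?W" using that adj_in_verts by auto
    then show ?thesis using that sub unfolding A_def
      by (auto intro: rtrancl_on_into_rtrancl_on)
  qed
  have "v \<in> exterior (verts G) ?E A"
    using uv closed[of _ v] by (auto simp: exterior_def A_def)
  moreover have "u \<in> A" using uv by (simp add: A_def)
  ultimately have "separating (verts G) ?E A" using sub by (auto simp: separating_def)
  moreover have "boundary ?E A \<subseteq> F" using closed by (auto simp: boundary_def)
  ultimately show ?thesis using that by blast
qed

section \<open>Bounds on the connectivity\<close>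

lemma (in digraph) connectivity_le:
  assumes "F \<subseteq> verts G"
    and "card (verts G - F) = 1 \<or> \<not> strongly_connected (G \<restriction> (verts G - F))"
  shows "connectivity G \<le> card F"
  unfolding connectivity_def
proof (rule Min_le)
  have "finite (card ` Pow (verts G))" by simp
  then show "finite {card F |F. F \<subseteq> verts G \<and>
      (card (verts G - F) = 1 \<or> \<not> strongly_connected (G \<restriction> (verts G - F)))}"
    by (rule rev_finite_subset) auto
qed (use assms in blast)

lemma (in digraph) connectivity_ge:
  assumes "verts G \<noteq> {}"
    and "\<And>F. F \<subseteq> verts G \<Longrightarrow>
      card (verts G - F) = 1 \<or> \<not> strongly_connected (G \<restriction> (verts G - F)) \<Longrightarrow> d \<le> card F"
  shows "d \<le> connectivity G"
proof -
  let ?S = "{card F |F. F \<subseteq> verts G \<and>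
      (card (verts G - F) = 1 \<or> \<not> strongly_connected (G \<restriction> (verts G - F)))}"
  have "finite (card ` Pow (verts G))" by simp
  then have "finite ?S" by (rule rev_finite_subset) auto
  \<comment> \<open>Deleting all vertices is admissible, so the minimum is over a nonempty
    set.\<close>
  moreover have "\<not> strongly_connected (G \<restriction> (verts G - verts G))"
    by (simp add: strongly_connected_def)
  then have "card (verts G) \<in> ?S" by blast
  ultimately have "connectivity G \<in> ?S" unfolding connectivity_def by (intro Min_in) auto
  then show ?thesis using assms(2) by auto
qed

text \<open>Deleting the out-neighbours of \<open>v\<close> keeps \<open>v\<close>, as there are no
  loops, and leaves it alone or unable to reach any other vertex.\<close>

lemma (in digraph) connectivity_le_out_degree:
  assumes v: "v \<in> verts G"
  shows "connectivity G \<le> out_degree G v"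
proof -
  let ?F = "arcs_ends G `` {v}" let ?W = "verts G - ?F"
  have vW: "v \<in> ?W" using v adj_not_same by auto
  have "card ?W = 1 \<or> \<not> strongly_connected (G \<restriction> ?W)"
  proof (cases "?W = {v}")
    case False
    then obtain w where w: "w \<in> ?W" "w \<noteq> v" using vW by auto
    have "x = v" if "(v, x) \<in> rtrancl_on ?W (arcs_ends (G \<restriction> ?W))" for x
      using that by (induct rule: rtrancl_on_induct) (auto simp: arcs_ends_induce)
    then show ?thesis using w vW by (auto simp: strongly_connected_def reachable_def)
  qed simp
  then have "connectivity G \<le> card ?F" by (intro connectivity_le) (auto dest: adj_in_verts)
  then show ?thesis by (simp add: card_out_neighbours)
qed

lemma (in digraph) connectivity_le_in_degree:
  assumes v: "v \<in> verts G"
  shows "connectivity G \<le> in_degree G v"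
proof -
  let ?F = "(arcs_ends G)\<inverse> `` {v}" let ?W = "verts G - ?F"
  have vW: "v \<in> ?W" using v adj_not_same by auto
  have "card ?W = 1 \<or> \<not> strongly_connected (G \<restriction> ?W)"
  proof (cases "?W = {v}")
    case False
    then obtain w where w: "w \<in> ?W" "w \<noteq> v" using vW by auto
    have "x \<noteq> v" if "(w, x) \<in> rtrancl_on ?W (arcs_ends (G \<restriction> ?W))" for x
      using that by (induct rule: rtrancl_on_induct) (use w in \<open>auto simp: arcs_ends_induce\<close>)
    then show ?thesis using w vW by (auto simp: strongly_connected_def reachable_def)
  qed simp
  then have "connectivity G \<le> card ?F" by (intro connectivity_le) (auto dest: adj_in_verts)
  then show ?thesis by (simp add: card_in_neighbours)
qed

lemma (in digraph) connectivity_le_min_semidegree: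
  assumes "verts G \<noteq> {}"
  shows "connectivity G \<le> min_semidegree G"
  using assms connectivity_le_out_degree connectivity_le_in_degree
  by (simp add: min_semidegree_def)

lemma (in digraph) min_semidegree_le:
  assumes "v \<in> verts G"
  shows "min_semidegree G \<le> card (arcs_ends G `` {v})"
    and "min_semidegree G \<le> card ((arcs_ends G)\<inverse> `` {v})"
  using assms unfolding min_semidegree_def card_out_neighbours card_in_neighbours
  by (auto intro: min.coboundedI1 min.coboundedI2)

section \<open>Equality for Bi-Cayley digraphs\<close>

theorem theorem2p6:
  fixes G :: "('a, 'm) monoid_scheme" and T0 T1 :: "'a set"
    and X :: "('a \<times> nat, ('a \<times> nat) \<times> ('a \<times> nat)) pre_digraph"
  assumes "group G" and "finite (carrier G)"
    and "T0 \<subseteq> carrier G" and "T1 \<subseteq> carrier G"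
    and "X = with_proj (bi_cayley_digraph G T0 T1)"
    and "strongly_connected X"
  shows "connectivity X = min_semidegree X"
proof (rule antisym)
  interpret group G by fact
  interpret X: digraph X using digraph_bi_cayley_digraph assms by simp
  let ?V = "carrier G \<times> {0, 1 :: nat}" and ?E = "arcs_ends X"
  have V: "verts X = ?V" using assms(5) by (simp add: bi_cayley_digraph_def)
  have E_eq: "?E = {((g, 0), (t0 \<otimes>\<^bsub>G\<^esub> g, 1)) | g t0. g \<in> carrier G \<and> t0 \<in> T0}
      \<union> {((t1 \<otimes>\<^bsub>G\<^esub> g, 1), (g, 0)) | g t1. g \<in> carrier G \<and> t1 \<in> T1}"
    using assms(5) by (simp add: bi_cayley_digraph_def)
  have V_ne: "verts X \<noteq> {}" using V by auto
  show "connectivity X \<le> min_semidegree X" using X.connectivity_le_min_semidegree[OF V_ne] .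
  have E_sub: "?E \<subseteq> ?V \<times> ?V" using assms(3,4) unfolding E_eq by auto
  have bip: "\<And>u v. (u, v) \<in> ?E \<Longrightarrow> snd u \<noteq> snd v" unfolding E_eq by auto
  \<comment> \<open>Associativity moves \<open>g\<close> past the left multiplier.\<close>
  have "(right_translate G g u, right_translate G g v) \<in> ?E"
    if "g \<in> carrier G" "(u, v) \<in> ?E" for g u v
    using that(2) unfolding E_eq
  proof (elim UnE CollectE exE conjE, goal_cases)
    case (1 x t0)
    then have "right_translate G g v = (t0 \<otimes>\<^bsub>G\<^esub> (x \<otimes>\<^bsub>G\<^esub> g), 1)" "right_translate G g u = (x \<otimes>\<^bsub>G\<^esub> g, 0)"
      using that(1) assms(3) by (auto simp: right_translate_def m_assoc)
    then show ?case using 1 that(1) by blast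
  next
    case (2 x t1)
    then have "right_translate G g u = (t1 \<otimes>\<^bsub>G\<^esub> (x \<otimes>\<^bsub>G\<^esub> g), 1)" "right_translate G g v = (x \<otimes>\<^bsub>G\<^esub> g, 0)"
      using that(1) assms(4) by (auto simp: right_translate_def m_assoc)
    then show ?case using 2 that(1) by blast
  qed
  then have inv: "right_invariant G ?E" by (auto simp: right_invariant_def)
  show "min_semidegree X \<le> connectivity X"
  proof (rule X.connectivity_ge[OF V_ne])
    fix F assume F: "F \<subseteq> verts X"
      "card (verts X - F) = 1 \<or> \<not> strongly_connected (X \<restriction> (verts X - F))"
    show "min_semidegree X \<le> card F"
    \<comment> \<open>Deletions leaving one vertex or none are handled together by counting: without
      loops, an out-degree is at most the number of other vertices.\<close>
    proof (cases "card (verts X - F) \<le> 1")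
      case True
      obtain v where v: "v \<in> verts X" using V_ne by auto
      have "?E `` {v} \<subseteq> verts X - {v}" using E_sub X.adj_not_same unfolding V by blast
      then have "card (?E `` {v}) \<le> card (verts X) - 1"
        using v by (metis X.finite_verts card_Diff_singleton card_mono finite_Diff)
      moreover have "card (verts X) \<le> card F + 1"
        using True F(1) X.finite_verts by (simp add: card_Diff_subset finite_subset)
      ultimately show ?thesis using X.min_semidegree_le(1)[OF v] by linarith
    next
      case False
      then have "F \<noteq> verts X" "\<not> strongly_connected (X \<restriction> (verts X - F))" using F by auto
      then obtain A where A: "separating (verts X) ?E A" "boundary ?E A \<subseteq> F"
        using X.ex_separating_set F(1) by metis
      have "min_semidegree X \<le> card (boundary ?E A)"
        by (rule card_boundary_separating_ge[OF assms(2) E_sub bip inv])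
          (use X.min_semidegree_le X.strongly_connected_closed_eq[OF assms(6)] A(1) V in auto)
      also have "\<dots> \<le> card F"
        using A(2) F(1) by (meson X.finite_verts card_mono finite_subset)
      finally show ?thesis .
    qed
  qed
qed

end
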